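(* Let $n\ge2$, let $a_0,b_0,c_0,d_0$ and $a,b,c,d$ be real with $a_0d_0-b_0c_0\neq0$ and $ad-bc\ne0$. Consider a design with points $x_1,\ldots,x_N$ and weights $p_1,\ldots,p_N$ for the weighted polynomial regression with variance function $\sigma_P^2(x;a_0,b_0,c_0,d_0)$, and the design with points $y_i=\varphi(x_i;a,b,c,d)$ and the same weights $p_i$, $1\le i\le N$, for the weighted polynomial regression with variance function $\sigma_P^2(y;a',b',c',d')$, where $(a',b',c',d')$ is determined by $$\varphi(\cdot;a',b',c',d')=\varphi(\cdot;a_0,b_0,c_0,d_0)\circ\varphi^{-1}(\cdot;a,b,c,d).$$ Then the two designs have the same volume.
   Context: Let $f_P(x)=(1,x,\ldots,x^{n-1})^\top$ and $g_P=f_P'$. For $ad-bc\neq 0$, $\varphi(x;a,b,c,d)=\frac{ax+b}{cx+d}$ is the real Möbius transformation on $\mathbb{R}\cup\{\pm\infty\}$ (with $+\infty$ and $-\infty$ identified), with $\pm\infty\mapsto a/c$ and $-d/c\mapsto\pm\infty$; $\varphi^{-1}(\cdot;a,b,c,d)=\varphi(\cdot;d,-b,-c,a)$. The variance functions are $$\sigma_P^2(x;a,b,c,d)=\{(b^2+d^2)+2(ab+cd)x+(a^2+c^2)x^2\}^{n-1}.$$ A design consists of points $x_i$ with weights $p_i>0$, $\sum_ip_i=1$. Its information matrix under variance function $\sigma^2$ is $M=\sum_i p_i f_P(x_i)f_P(x_i)^\top/\sigma^2(x_i)$, where a point at $\pm\infty$ contributes the limit of $f_P(x)f_P(x)^\top/\sigma^2(x)$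 as $x\to\pm\infty$; designs are assumed to have nonsingular information matrix. The volume of the design is $\mathrm{Vol}_1(\gamma_{M^{-1}})$, where for positive definite $\Sigma$ $$\mathrm{Vol}_1(\gamma_\Sigma)=2\int_{-\infty}^{\infty}\frac{\sqrt{(f_P^\top\Sigma f_P)(g_P^\top\Sigma g_P)-(f_P^\top\Sigma g_P)^2}}{f_P^\top\Sigma f_P}\,dx .$$ (The quadruple $(a',b',c',d')$ is determined only up to a nonzero scalar, which rescales $M$ and does not affect the volume.) *)

theory Defs
  imports
    "HOL-Analysis.Analysis"
    "Jordan_Normal_Form.Gauss_Jordan_Elimination"
begin

unbundle no inner_syntax
unbundle no Finite_Cartesian_Product.vec_syntax

section \<open>Real Moebius transformations\<close>

text \<open>The real line with both infinities identified is \<open>real option\<close>;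
  \<open>None\<close> is the point at infinity. For \<open>c = 0\<close> the quotients \<open>a / c\<close> and \<open>- d / c\<close> both
  stand for infinity, which is why that case is separated below.\<close>

definition mobius :: "real \<Rightarrow> real \<Rightarrow> real \<Rightarrow> real \<Rightarrow> real option \<Rightarrow> real option" where
  "mobius a b c d z =
     (case z of
        None \<Rightarrow> if c = 0 then None else Some (a / c)
      | Some x \<Rightarrow> if c * x + d = 0 then None else Some ((a * x + b) / (c * x + d)))"

lemma mobius_cancel:
  assumes "a * d - b * c \<noteq> 0"
  shows "mobius d (- b) (- c) a (mobius a b c d z) = z"
proof (cases z)
  case None
  then show ?thesis using assms by (auto simp: mobius_def field_simps)
next
  case (Some x)
  show ?thesis
  proof (cases "c * x + d = 0")
    case True
    then have c: "c \<noteq> 0" using assms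
      by auto
    with True have "x = - d / c" by (simp add: field_simps)
    with Some True c show ?thesis by (simp add: mobius_def)
  next
    case False
    define w where "w = (a * x + b) / (c * x + d)"
    have eq1: "- c * w + a = (a * d - b * c) / (c * x + d)"
      using False by (simp add: w_def divide_simps) (simp add: algebra_simps)
    have eq2: "d * w + - b = x * (a * d - b * c) / (c * x + d)"
      using False by (simp add: w_def divide_simps) (simp add: algebra_simps)
    from Some False have "mobius a b c d z = Some w"
      by (simp add: mobius_def w_def)
    moreover have "mobius d (- b) (- c) a (Some w)
        = Some ((x * (a * d - b * c) / (c * x + d)) / ((a * d - b * c) / (c * x + d)))"
      unfolding mobius_def option.case eq1 eq2 using False assms by simp
    ultimately show ?thesis using Some False assms by simp
  qed
qed

lemma inv_mobius:
  assumes "a * d - b * c \<noteq> 0"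
  shows "inv_into UNIV (mobius a b c d) = mobius d (- b) (- c) a"
proof (rule Hilbert_Choice.inv_equality)
  show "mobius d (- b) (- c) a (mobius a b c d z) = z" for z
    using assms by (rule mobius_cancel)
  have "d * a - (- b) * (- c) \<noteq> 0" using assms by (simp add: mult.commute)
  from mobius_cancel[OF this]
  show "mobius a b c d (mobius d (- b) (- c) a z) = z" for z by simp
qed

section \<open>Weighted polynomial regression\<close>

definition f_P :: "nat \<Rightarrow> real \<Rightarrow> real vec" where
  "f_P n x = vec n (\<lambda>i. x ^ i)"

definition g_P :: "nat \<Rightarrow> real \<Rightarrow> real vec" where
  "g_P n x = vec n (\<lambda>i. deriv (\<lambda>t. f_P n t $ i) x)"

definition variance_P :: "nat \<Rightarrow> real \<Rightarrow> real \<Rightarrow> real \<Rightarrow> real \<Rightarrow> real \<Rightarrow> real" where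
  "variance_P n a b c d x =
     ((b\<^sup>2 + d\<^sup>2) + 2 * (a * b + c * d) * x + (a\<^sup>2 + c\<^sup>2) * x\<^sup>2) ^ (n - 1)"

text \<open>The matrix \<open>f_P f_P\<^sup>T / s\<close> at a design point, where \<open>s\<close> is the variance function. At
  infinity it is the entrywise limit; the filter \<open>at_infinity\<close> on the reals covers
  both \<open>x \<rightarrow> +\<infinity>\<close> and \<open>x \<rightarrow> -\<infinity>\<close>.\<close>

definition point_info :: "nat \<Rightarrow> (real \<Rightarrow> real) \<Rightarrow> real option \<Rightarrow> real mat" where
  "point_info n s z =
     mat n n (\<lambda>(i, j).
       case z of
         Some x \<Rightarrow> f_P n x $ i * f_P n x $ j / s x
       | None \<Rightarrow> Lim at_infinity (\<lambda>x. f_P n x $ i * f_P n x $ j / s x))"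

text \<open>The limit in \<^const>\<open>point_info\<close> exists for the variance functions considered.\<close>

lemma tendsto_point_info_at_infinity:
  fixes a b c d :: real
  assumes det: "a * d - b * c \<noteq> 0" and i: "i < n" and j: "j < n"
  shows "((\<lambda>x. f_P n x $ i * f_P n x $ j / variance_P n a b c d x) \<longlongrightarrow>
           (if i = n - 1 \<and> j = n - 1 then 1 / (a\<^sup>2 + c\<^sup>2) ^ (n - 1) else 0)) at_infinity"
proof -
  define m where "m = 2 * (n - 1) - (i + j)"
  have m: "i + j + m = 2 * (n - 1)" using i j by (simp add: m_def)
  have ac: "a\<^sup>2 + c\<^sup>2 \<noteq> 0" using det by (auto simp: sum_power2_eq_zero_iff)
  define h where "h = (\<lambda>u :: real. u ^ m / ((b\<^sup>2 + d\<^sup>2) * u\<^sup>2 + 2 * (a * b + c * d) * u + (a\<^sup>2 + c\<^sup>2)) ^ (n - 1))"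
  have "(h \<longlongrightarrow> h 0) (nhds 0)"
    unfolding h_def by (intro tendsto_intros filterlim_ident) (use ac in auto)
  moreover have "filterlim (inverse :: real \<Rightarrow> real) (nhds 0) at_infinity"
    by (rule tendsto_inverse_0)
  ultimately have lim: "((\<lambda>x. h (inverse x)) \<longlongrightarrow> h 0) at_infinity"
    by (rule filterlim_compose)
  have eq: "h (inverse x) = f_P n x $ i * f_P n x $ j / variance_P n a b c d x" if x: "x \<noteq> 0" for x
  proof -
    have "(b\<^sup>2 + d\<^sup>2) * (inverse x)\<^sup>2 + 2 * (a * b + c * d) * inverse x + (a\<^sup>2 + c\<^sup>2)
      = ((b\<^sup>2 + d\<^sup>2) + 2 * (a * b + c * d) * x + (a\<^sup>2 + c\<^sup>2) * x\<^sup>2) / x\<^sup>2" (is "_ = ?q / _")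
      using x by (simp add: field_simps power2_eq_square)
    then have "h (inverse x) = inverse x ^ m / (?q / x\<^sup>2) ^ (n - 1)"
      by (simp add: h_def)
    also have "\<dots> = inverse x ^ m * x ^ (i + j + m) / ?q ^ (n - 1)"
      by (simp add: m power_divide power_mult)
    also have "\<dots> = x ^ (i + j) / ?q ^ (n - 1)"
      using x by (simp add: power_add power_inverse)
    finally show ?thesis
      using i j by (simp add: f_P_def variance_P_def power_add)
  qed
  have "h 0 = (if i = n - 1 \<and> j = n - 1 then 1 / (a\<^sup>2 + c\<^sup>2) ^ (n - 1) else 0)"
    using i j by (auto simp: h_def m_def power_0_left)
  moreover have "\<forall>\<^sub>F x in at_infinity. h (inverse x) = f_P n x $ i * f_P n x $ j / variance_P n a b c d x"
    unfolding eventually_at_infinity by (rule exI[of _ 1]) (auto intro!: eq)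
  ultimately show ?thesis
    using lim tendsto_cong by force
qed

definition info_mat ::
    "nat \<Rightarrow> (real \<Rightarrow> real) \<Rightarrow> nat \<Rightarrow> (nat \<Rightarrow> real option) \<Rightarrow> (nat \<Rightarrow> real) \<Rightarrow> real mat" where
  "info_mat n s N x p = mat n n (\<lambda>(i, j). \<Sum>k = 1..N. p k * point_info n s (x k) $$ (i, j))"

definition design_weights :: "nat \<Rightarrow> (nat \<Rightarrow> real) \<Rightarrow> bool" where
  "design_weights N p \<longleftrightarrow> (\<forall>k\<in>{1..N}. p k > 0) \<and> (\<Sum>k = 1..N. p k) = 1"

section \<open>Volume\<close>

definition Vol1 :: "nat \<Rightarrow> real mat \<Rightarrow> real" where
  "Vol1 n S = 2 * (LBINT x.
     sqrt ((f_P n x \<bullet> (S *\<^sub>v f_P n x)) * (g_P n x \<bullet> (S *\<^sub>v g_P n x))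
           - (f_P n x \<bullet> (S *\<^sub>v g_P n x))\<^sup>2)
     / (f_P n x \<bullet> (S *\<^sub>v f_P n x)))"

text \<open>\<^const>\<open>mat_inverse\<close> returns an option, which is \<open>Some\<close> exactly for nonsingular square matrices.\<close>

definition design_volume ::
    "nat \<Rightarrow> (real \<Rightarrow> real) \<Rightarrow> nat \<Rightarrow> (nat \<Rightarrow> real option) \<Rightarrow> (nat \<Rightarrow> real) \<Rightarrow> real" where
  "design_volume n s N x p = Vol1 n (the (mat_inverse (info_mat n s N x p)))"

end

theory Submission
  imports Defs "Jordan_Normal_Form.Determinant"
begin

text \<open>On the homogeneous moment curve \<open>F(u, v) = (u\<^sup>i v\<^sup>n\<^sup>-\<^sup>1\<^sup>-\<^sup>i)\<^sub>i\<close> a linear substitution \<open>B\<close> acts by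
  an invertible matrix \<open>R\<close>, \<open>F(B w) = R F(w)\<close>, and the variance function is
  \<open>\<bar>A w\<bar>\<^sup>2\<close> to the power \<open>n - 1\<close> for the matrix \<open>A\<close> of its parameters. Equality of Moebius maps
  gives \<open>A' B = l A\<^sub>0\<close> for a scalar \<open>l\<close>, so \<open>M' = R M R\<^sup>T / k\<close> with \<open>k = l\<^bsup>2(n-1)\<^esup> > 0\<close>, including the
  points at infinity. The bilinear form of \<open>M'\<close>'s inverse therefore pulls back under \<open>R\<close> to
  \<open>k\<close> times that of \<open>M\<close>'s inverse. Since \<open>f(\<phi>(x))\<close> is a scalar multiple of \<open>R f(x)\<close>, the
  integrand at \<open>\<phi>(x)\<close> times \<open>\<bar>\<phi>'(x)\<bar>\<close> is the original integrand at \<open>x\<close>, and the volumes agree by the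
  change of variables \<open>\<phi>\<close>, which is a bijection off two points.\<close>

section \<open>Projective coordinates\<close>

text \<open>Affine chart of the real projective line: the ratio of homogeneous coordinates, with
  \<open>v = 0\<close> as the point at infinity. The pair \<open>(0, 0)\<close> also falls there by
  default, so the action of Moebius maps is stated for nonzero pairs only.\<close>

definition proj_pt :: "real \<Rightarrow> real \<Rightarrow> real option" where
  "proj_pt u v = (if v = 0 then None else Some (u / v))"

lemma proj_pt_exhaust:
  obtains u v where "z = proj_pt u v" "u \<noteq> 0 \<or> v \<noteq> 0"
proof (cases z)
  case None
  show thesis by (rule that[of 1 0]) (auto simp: None proj_pt_def)
next
  case (Some x)
  show thesis by (rule that[of x 1]) (auto simp: Some proj_pt_def)
qed

lemma proj_pt_eqD:
  assumes "proj_pt u v = proj_pt u' v'"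
  shows "u * v' = u' * v"
  using assms by (auto simp: proj_pt_def field_simps split: if_splits)

lemma linear_map_nonzero:
  fixes a b c d u v :: real
  assumes "a * d - b * c \<noteq> 0" "u \<noteq> 0 \<or> v \<noteq> 0"
  shows "a * u + b * v \<noteq> 0 \<or> c * u + d * v \<noteq> 0"
proof (rule ccontr)
  assume "\<not> ?thesis"
  then have z: "a * u + b * v = 0" "c * u + d * v = 0" by auto
  \<comment> \<open>Applying the adjugate matrix recovers \<open>(u, v)\<close> up to the
    determinant.\<close>
  have "(a * d - b * c) * u = d * (a * u + b * v) - b * (c * u + d * v)"
    "(a * d - b * c) * v = a * (c * u + d * v) - c * (a * u + b * v)"
    by (simp_all add: algebra_simps)
  with z assms show False by simp
qed

text \<open>In homogeneous coordinates a Moebius map is linear. This absorbs the case distinctions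
  at the pole and at infinity.\<close>

lemma mobius_proj_pt:
  assumes "a * d - b * c \<noteq> 0" "u \<noteq> 0 \<or> v \<noteq> 0"
  shows "mobius a b c d (proj_pt u v) = proj_pt (a * u + b * v) (c * u + d * v)"
proof (cases "v = 0")
  case True
  with assms show ?thesis by (auto simp: mobius_def proj_pt_def)
next
  case False
  then have "c * (u / v) + d = (c * u + d * v) / v" "a * (u / v) + b = (a * u + b * v) / v"
    by (simp_all add: field_simps)
  with False show ?thesis by (simp add: mobius_def proj_pt_def)
qed

text \<open>Equal images as projective points mean that a cross product vanishes. It is a quadratic
  form in \<open>(u, v)\<close>, and its three coefficients give the equations between the two
  parameter matrices.\<close>

lemma mobius_eq_imp_proportional:
  assumes det: "a * d - b * c \<noteq> 0" and det': "p * s - q * r \<noteq> 0"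
    and eq: "mobius p q r s = mobius a b c d"
  obtains k where "k \<noteq> 0" "p = k * a" "q = k * b" "r = k * c" "s = k * d"
proof -
  have cross: "(p * u + q * v) * (c * u + d * v) = (a * u + b * v) * (r * u + s * v)"
    if "u \<noteq> 0 \<or> v \<noteq> 0" for u v
    using mobius_proj_pt[OF det that] mobius_proj_pt[OF det' that] eq by (metis proj_pt_eqD)
  \<comment> \<open>The points infinity, 0 and 1 isolate the coefficients of \<open>u ^ 2\<close>,
    \<open>v ^ 2\<close> and \<open>u * v\<close>.\<close>
  have e1: "p * c = a * r" using cross[of 1 0] by simp
  have e2: "q * d = b * s" using cross[of 0 1] by simp
  have e3: "p * d + q * c = a * s + b * r"
    using cross[of 1 1] e1 e2 by (simp add: algebra_simps)
  \<comment> \<open>Forced: \<open>p = k * a\<close> and \<open>r = k * c\<close> give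
    \<open>p * d - b * r = k * (a * d - b * c)\<close>. No entry that might vanish is divided
    by.\<close>
  define k where "k = (p * d - b * r) / (a * d - b * c)"
  \<comment> \<open>Each defect of proportionality is a linear combination of the differences of the
    two sides of \<open>e1\<close>, \<open>e2\<close> and \<open>e3\<close>.\<close>
  have "p * (a * d - b * c) - (p * d - b * r) * a = - b * (p * c - a * r)"
    "q * (a * d - b * c) - (p * d - b * r) * b
      = a * (q * d - b * s) - b * (p * d + q * c - (a * s + b * r))"
    "r * (a * d - b * c) - (p * d - b * r) * c = - d * (p * c - a * r)"
    "s * (a * d - b * c) - (p * d - b * r) * d
      = c * (q * d - b * s) - d * (p * d + q * c - (a * s + b * r))"
    by (simp_all add: algebra_simps)
  then have "p * (a * d - b * c) = (p * d - b * r) * a" "q * (a * d - b * c) = (p * d - b * r) * b"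
    "r * (a * d - b * c) = (p * d - b * r) * c" "s * (a * d - b * c) = (p * d - b * r) * d"
    unfolding e1 e2 e3 by simp_all
  then have k: "p = k * a" "q = k * b" "r = k * c" "s = k * d"
    using det by (simp_all add: k_def field_simps)
  with det' have "k \<noteq> 0" by auto
  from that[OF this k] show thesis .
qed

section \<open>The homogeneous moment curve\<close>

definition moment_vec :: "nat \<Rightarrow> real \<Rightarrow> real \<Rightarrow> real vec" where
  "moment_vec n u v = vec n (\<lambda>i. u ^ i * v ^ (n - 1 - i))"

text \<open>The action of the linear substitution on binary forms of degree \<open>n - 1\<close>:
  row \<open>i\<close> expands the \<open>i\<close>-th transformed monomial in the old ones, read
  off from the dehomogenized product.\<close>

definition subst_mat :: "nat \<Rightarrow> real \<Rightarrow> real \<Rightarrow> real \<Rightarrow> real \<Rightarrow> real mat" where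
  "subst_mat n a b c d = mat n n (\<lambda>(i, j). coeff ([:b, a:] ^ i * [:d, c:] ^ (n - 1 - i)) j)"

lemma moment_vec_carrier [simp]: "moment_vec n u v \<in> carrier_vec n"
  by (simp add: moment_vec_def)

lemma subst_mat_carrier [simp]: "subst_mat n a b c d \<in> carrier_mat n n"
  by (simp add: subst_mat_def)

lemma dim_f_P [simp]: "dim_vec (f_P n x) = n"
  by (simp add: f_P_def)

lemma f_P_carrier [simp]: "f_P n x \<in> carrier_vec n"
  by (simp add: f_P_def)

lemma dim_g_P [simp]: "dim_vec (g_P n x) = n"
  by (simp add: g_P_def)

lemma g_P_carrier [simp]: "g_P n x \<in> carrier_vec n"
  by (simp add: g_P_def)

lemma f_P_eq_moment_vec: "f_P n x = moment_vec n x 1"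
  by (simp add: f_P_def moment_vec_def)

lemma moment_vec_scale: "moment_vec n (t * u) (t * v) = t ^ (n - 1) \<cdot>\<^sub>v moment_vec n u v"
proof (rule eq_vecI)
  fix i assume "i < dim_vec (t ^ (n - 1) \<cdot>\<^sub>v moment_vec n u v)"
  then have i: "i < n" by (simp add: moment_vec_def)
  then have "t ^ (n - 1) = t ^ i * t ^ (n - 1 - i)"
    by (simp flip: power_add)
  with i show "moment_vec n (t * u) (t * v) $ i = (t ^ (n - 1) \<cdot>\<^sub>v moment_vec n u v) $ i"
    by (simp add: moment_vec_def power_mult_distrib)
qed (simp add: moment_vec_def)

section \<open>Homogenization of univariate polynomials\<close>

definition homogenize :: "nat \<Rightarrow> real poly \<Rightarrow> real \<Rightarrow> real \<Rightarrow> real" where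
  "homogenize m p u v = (\<Sum>j\<le>m. coeff p j * u ^ j * v ^ (m - j))"

text \<open>The product splits into a part with factor \<open>b\<close> and a shifted part with
  factor \<open>a\<close>. Homogenizing to a prescribed bound \<open>m\<close> rather than to the
  exact degree lets \<open>a = 0\<close> pass without a separate case.\<close>

lemma homogenize_linear_mult:
  assumes "degree p \<le> m"
  shows "homogenize (Suc m) ([:b, a:] * p) u v = (a * u + b * v) * homogenize m p u v"
proof -
  have top: "coeff p (Suc m) = 0" using assms by (intro coeff_eq_0) simp
  have "homogenize (Suc m) ([:b, a:] * p) u v
      = (\<Sum>j\<le>Suc m. b * (coeff p j * u ^ j * v ^ (Suc m - j)))
      + (\<Sum>j\<le>Suc m. coeff (pCons 0 (Polynomial.smult a p)) j * u ^ j * v ^ (Suc m - j))"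
    unfolding homogenize_def sum.distrib[symmetric] by (rule sum.cong) (auto simp: algebra_simps)
  also have "(\<Sum>j\<le>Suc m. b * (coeff p j * u ^ j * v ^ (Suc m - j))) = b * v * homogenize m p u v"
    by (simp add: homogenize_def top sum_distrib_left Suc_diff_le ac_simps)
  also have "(\<Sum>j\<le>Suc m. coeff (pCons 0 (Polynomial.smult a p)) j * u ^ j * v ^ (Suc m - j))
      = a * u * homogenize m p u v"
    unfolding sum.atMost_Suc_shift by (simp add: homogenize_def sum_distrib_left ac_simps)
  finally show ?thesis by (simp add: algebra_simps)
qed

lemma degree_linear_power_mult: "degree ([:b, a :: real:] ^ k * p) \<le> k + degree p"
proof -
  have "degree ([:b, a:] ^ k) \<le> degree [:b, a:] * k" by (rule degree_power_le)
  also have "\<dots> \<le> k" by simp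
  finally show ?thesis using degree_mult_le[of "[:b, a:] ^ k" p] by linarith
qed

lemma homogenize_linear_power_mult:
  assumes "degree p \<le> m"
  shows "homogenize (k + m) ([:b, a:] ^ k * p) u v = (a * u + b * v) ^ k * homogenize m p u v"
proof (induction k)
  case (Suc k)
  have "degree ([:b, a:] ^ k * p) \<le> k + m"
    using degree_linear_power_mult[of b a k p] assms by linarith
  from homogenize_linear_mult[OF this, of b a u v] Suc show ?case
    by (simp only: power_Suc mult.assoc add_Suc)
qed simp

text \<open>Row \<open>i\<close> against the monomials in \<open>(u, v)\<close> is the
  homogenization of a product of powers of linear polynomials, and homogenization is multiplicative
  on these.\<close>

lemma subst_mat_moment_vec:
  "subst_mat n a b c d *\<^sub>v moment_vec n u v = moment_vec n (a * u + b * v) (c * u + d * v)"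
proof (rule eq_vecI)
  fix i assume "i < dim_vec (moment_vec n (a * u + b * v) (c * u + d * v))"
  then have i: "i < n" by (simp add: moment_vec_def)
  define l where "l = n - 1 - i"
  have n: "n = Suc (i + l)" using i by (simp add: l_def)
  have hl: "homogenize l ([:d, c:] ^ l) u v = (c * u + d * v) ^ l"
    using homogenize_linear_power_mult[of 1 0 l d c u v] by (simp add: homogenize_def)
  have dl: "degree ([:d, c:] ^ l) \<le> l"
    using degree_linear_power_mult[of d c l 1] by simp
  have "(subst_mat n a b c d *\<^sub>v moment_vec n u v) $ i
      = (\<Sum>j<n. coeff ([:b, a:] ^ i * [:d, c:] ^ l) j * (u ^ j * v ^ (n - 1 - j)))"
    using i by (simp add: subst_mat_def moment_vec_def scalar_prod_def l_def atLeast0LessThan)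
  also have "\<dots> = homogenize (i + l) ([:b, a:] ^ i * [:d, c:] ^ l) u v"
    unfolding homogenize_def n lessThan_Suc_atMost by (simp add: mult.assoc)
  also have "\<dots> = (a * u + b * v) ^ i * (c * u + d * v) ^ l"
    using homogenize_linear_power_mult[OF dl] hl by simp
  finally show "(subst_mat n a b c d *\<^sub>v moment_vec n u v) $ i
      = moment_vec n (a * u + b * v) (c * u + d * v) $ i"
    using i by (simp add: moment_vec_def l_def)
qed (simp add: moment_vec_def subst_mat_def)

section \<open>Invertibility of the substitution matrix\<close>

lemma smult_mat_mult_vec:
  fixes A :: "'a :: comm_semiring_0 mat"
  assumes "A \<in> carrier_mat m n" "v \<in> carrier_vec n"
  shows "(k \<cdot>\<^sub>m A) *\<^sub>v v = k \<cdot>\<^sub>v (A *\<^sub>v v)"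
  using assms by (intro eq_vecI) (auto simp: scalar_prod_def sum_distrib_left ac_simps)

text \<open>Each row holds the coefficients of a real polynomial function, and such a function
  determines its coefficients. Matrix identities may thus be checked on the moment curve.\<close>

lemma mat_eq_if_eq_on_f_P:
  assumes A: "A \<in> carrier_mat n n" and B: "B \<in> carrier_mat n n"
    and eq: "\<And>x. A *\<^sub>v f_P n x = B *\<^sub>v f_P n x"
  shows "A = B"
proof (rule eq_matI)
  fix i j assume "i < dim_row B" "j < dim_col B"
  then have ij: "i < n" "j < n" using B by auto
  then obtain m where n: "n = Suc m" using less_imp_Suc_add by blast
  have row: "(C *\<^sub>v f_P n x) $ i = (\<Sum>k\<le>m. C $$ (i, k) * x ^ k)" if "C \<in> carrier_mat n n" for C x
    using that ij by (simp add: f_P_def scalar_prod_def n atLeast0LessThan flip: lessThan_Suc_atMost)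
  have "\<forall>x. (\<Sum>k\<le>m. A $$ (i, k) * x ^ k) = (\<Sum>k\<le>m. B $$ (i, k) * x ^ k)"
    using eq row[OF A] row[OF B] by metis
  then show "A $$ (i, j) = B $$ (i, j)"
    using ij n unfolding polyfun_eq_coeffs by simp
qed (use A B in auto)

text \<open>The two substitutions compose to multiplication of \<open>(u, v)\<close> by the
  determinant, which scales the moment curve by the power \<open>n - 1\<close> of it.\<close>

lemma subst_mat_adjugate:
  "subst_mat n d (- b) (- c) a * subst_mat n a b c d = (a * d - b * c) ^ (n - 1) \<cdot>\<^sub>m 1\<^sub>m n"
proof (rule mat_eq_if_eq_on_f_P)
  fix x
  have "(subst_mat n d (- b) (- c) a * subst_mat n a b c d) *\<^sub>v f_P n x
      = subst_mat n d (- b) (- c) a *\<^sub>v (subst_mat n a b c d *\<^sub>v moment_vec n x 1)"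
    unfolding f_P_eq_moment_vec by (intro assoc_mult_mat_vec[of _ n n _ n]) auto
  also have "\<dots> = moment_vec n (d * (a * x + b) - b * (c * x + d)) (a * (c * x + d) - c * (a * x + b))"
    by (simp add: subst_mat_moment_vec)
  also have "\<dots> = moment_vec n ((a * d - b * c) * x) ((a * d - b * c) * 1)"
    by (simp add: algebra_simps)
  also have "\<dots> = (a * d - b * c) ^ (n - 1) \<cdot>\<^sub>v f_P n x"
    unfolding moment_vec_scale by (simp add: f_P_eq_moment_vec)
  also have "\<dots> = ((a * d - b * c) ^ (n - 1) \<cdot>\<^sub>m 1\<^sub>m n) *\<^sub>v f_P n x"
    by (subst smult_mat_mult_vec[of _ n n]) auto
  finally show "(subst_mat n d (- b) (- c) a * subst_mat n a b c d) *\<^sub>v f_P n x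
      = ((a * d - b * c) ^ (n - 1) \<cdot>\<^sub>m 1\<^sub>m n) *\<^sub>v f_P n x" .
qed (auto intro!: mult_carrier_mat[of _ n n])

lemma subst_mat_left_inverse:
  assumes "a * d - b * c \<noteq> 0"
  obtains T where "T \<in> carrier_mat n n" "T * subst_mat n a b c d = 1\<^sub>m n"
proof
  define k where "k = (a * d - b * c) ^ (n - 1)"
  have "k \<noteq> 0" using assms by (simp add: k_def)
  show "inverse k \<cdot>\<^sub>m subst_mat n d (- b) (- c) a \<in> carrier_mat n n" by simp
  have "inverse k \<cdot>\<^sub>m subst_mat n d (- b) (- c) a * subst_mat n a b c d
      = inverse k \<cdot>\<^sub>m (k \<cdot>\<^sub>m 1\<^sub>m n)"
    unfolding k_def subst_mat_adjugate[symmetric] by (rule mult_smult_assoc_mat[of _ n n _ n]) auto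
  also have "\<dots> = 1\<^sub>m n" using \<open>k \<noteq> 0\<close> by (intro eq_matI) auto
  finally show "inverse k \<cdot>\<^sub>m subst_mat n d (- b) (- c) a * subst_mat n a b c d = 1\<^sub>m n" .
qed

section \<open>Transformation of the information matrix\<close>

definition var_form :: "real \<Rightarrow> real \<Rightarrow> real \<Rightarrow> real \<Rightarrow> real \<Rightarrow> real \<Rightarrow> real" where
  "var_form a b c d u v = (a * u + b * v)\<^sup>2 + (c * u + d * v)\<^sup>2"

lemma variance_P_eq: "variance_P n a b c d x = var_form a b c d x 1 ^ (n - 1)"
proof -
  have "(b\<^sup>2 + d\<^sup>2) + 2 * (a * b + c * d) * x + (a\<^sup>2 + c\<^sup>2) * x\<^sup>2 = var_form a b c d x 1"
    by (simp add: var_form_def power2_eq_square algebra_simps)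
  then show ?thesis by (simp add: variance_P_def)
qed

lemma var_form_scale: "var_form a b c d (t * u) (t * v) = t\<^sup>2 * var_form a b c d u v"
  by (simp add: var_form_def power2_eq_square algebra_simps)

text \<open>Numerator and denominator are homogeneous of the same degree \<open>2 * (n - 1)\<close>,
  so the quotient depends only on the projective point. At \<open>v = 0\<close> it is the limit at
  infinity.\<close>

lemma point_info_proj_pt:
  assumes det: "a * d - b * c \<noteq> 0" and uv: "u \<noteq> 0 \<or> v \<noteq> 0" and ij: "i < n" "j < n"
  shows "point_info n (variance_P n a b c d) (proj_pt u v) $$ (i, j)
       = moment_vec n u v $ i * moment_vec n u v $ j / var_form a b c d u v ^ (n - 1)"
proof (cases "v = 0")
  case True
  then have u: "u \<noteq> 0" using uv by simp
  have "point_info n (variance_P n a b c d) (proj_pt u v) $$ (i, j)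
      = (if i = n - 1 \<and> j = n - 1 then 1 / (a\<^sup>2 + c\<^sup>2) ^ (n - 1) else 0)"
    using ij True
      tendsto_Lim[OF trivial_limit_at_infinity tendsto_point_info_at_infinity[OF det ij]]
    by (simp add: point_info_def proj_pt_def)
  \<comment> \<open>By \<open>0 ^ 0 = 1\<close> only the entry \<open>i = j = n - 1\<close>
    survives, and there the powers of \<open>u\<close> cancel.\<close>
  also have "\<dots> = (u ^ i * 0 ^ (n - 1 - i)) * (u ^ j * 0 ^ (n - 1 - j))
      / (u\<^sup>2 * (a\<^sup>2 + c\<^sup>2)) ^ (n - 1)"
    using ij u by (auto simp: power_0_left power_mult_distrib power_mult[symmetric]
        mult_2 power_add[symmetric])
  also have "u\<^sup>2 * (a\<^sup>2 + c\<^sup>2) = var_form a b c d u v"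
    by (simp add: True var_form_def algebra_simps power_mult_distrib)
  finally show ?thesis using ij True by (simp add: moment_vec_def)
next
  case False
  have m: "moment_vec n u v = v ^ (n - 1) \<cdot>\<^sub>v f_P n (u / v)"
    using moment_vec_scale[of n v "u / v" 1] False by (simp add: f_P_eq_moment_vec)
  have q: "var_form a b c d u v = v\<^sup>2 * var_form a b c d (u / v) 1"
    using var_form_scale[of a b c d v "u / v" 1] False by simp
  have v2: "(v\<^sup>2) ^ (n - 1) = v ^ (n - 1) * v ^ (n - 1)"
    by (simp add: power2_eq_square power_mult_distrib)
  have "i < dim_vec (f_P n (u / v))" "j < dim_vec (f_P n (u / v))"
    using ij by (simp_all add: f_P_def)
  then show ?thesis
    using False ij unfolding m q power_mult_distrib v2
    by (simp add: point_info_def proj_pt_def variance_P_eq)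
qed

text \<open>The equations \<open>rel\<close> form a matrix identity, which multiplies the quadratic
  form by \<open>k ^ 2\<close>, while \<open>R\<close> transforms the moment vector. Homogeneous
  coordinates treat finite points and infinity alike.\<close>

lemma point_info_mobius:
  assumes det: "a * d - b * c \<noteq> 0" and det0: "a0 * d0 - b0 * c0 \<noteq> 0"
    and det': "a' * d' - b' * c' \<noteq> 0"
    and rel: "a' * a + b' * c = k * a0" "a' * b + b' * d = k * b0"
      "c' * a + d' * c = k * c0" "c' * b + d' * d = k * d0"
    and ij: "i < n" "j < n"
  defines "R \<equiv> subst_mat n a b c d"
  shows "point_info n (variance_P n a' b' c' d') (mobius a b c d z) $$ (i, j)
       = inverse (k\<^sup>2 ^ (n - 1)) * (\<Sum>s<n. \<Sum>t<n. R $$ (i, s) * R $$ (j, t)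
           * point_info n (variance_P n a0 b0 c0 d0) z $$ (s, t))"
proof -
  obtain u v where z: "z = proj_pt u v" and uv: "u \<noteq> 0 \<or> v \<noteq> 0" by (rule proj_pt_exhaust)
  let ?u = "a * u + b * v" and ?v = "c * u + d * v"
  have "a' * ?u + b' * ?v = (a' * a + b' * c) * u + (a' * b + b' * d) * v"
    "c' * ?u + d' * ?v = (c' * a + d' * c) * u + (c' * b + d' * d) * v"
    by (simp_all add: algebra_simps)
  then have "a' * ?u + b' * ?v = k * (a0 * u + b0 * v)" "c' * ?u + d' * ?v = k * (c0 * u + d0 * v)"
    unfolding rel by (simp_all add: algebra_simps)
  then have q: "var_form a' b' c' d' ?u ?v = k\<^sup>2 * var_form a0 b0 c0 d0 u v"
    unfolding var_form_def by (simp only: power_mult_distrib distrib_left[of "k\<^sup>2"])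
  have m: "moment_vec n ?u ?v $ i = (\<Sum>s<n. R $$ (i, s) * moment_vec n u v $ s)" if "i < n" for i
    unfolding R_def subst_mat_moment_vec[symmetric] using that
    by (simp add: scalar_prod_def subst_mat_def moment_vec_def atLeast0LessThan)
  have "point_info n (variance_P n a' b' c' d') (mobius a b c d z) $$ (i, j)
      = moment_vec n ?u ?v $ i * moment_vec n ?u ?v $ j / (k\<^sup>2 * var_form a0 b0 c0 d0 u v) ^ (n - 1)"
    unfolding z mobius_proj_pt[OF det uv] q[symmetric]
    by (rule point_info_proj_pt[OF det' linear_map_nonzero[OF det uv] ij])
  also have "\<dots> = inverse (k\<^sup>2 ^ (n - 1)) * (\<Sum>s<n. \<Sum>t<n. R $$ (i, s) * R $$ (j, t)
      * (moment_vec n u v $ s * moment_vec n u v $ t / var_form a0 b0 c0 d0 u v ^ (n - 1)))"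
    unfolding m[OF ij(1)] m[OF ij(2)] sum_product
    by (simp add: power_mult_distrib divide_inverse sum_distrib_left sum_distrib_right ac_simps)
  also have "\<dots> = inverse (k\<^sup>2 ^ (n - 1)) * (\<Sum>s<n. \<Sum>t<n. R $$ (i, s) * R $$ (j, t)
      * point_info n (variance_P n a0 b0 c0 d0) z $$ (s, t))"
    unfolding z by (simp add: point_info_proj_pt[OF det0 uv])
  finally show ?thesis .
qed

lemma info_mat_carrier [simp]: "info_mat n s N x p \<in> carrier_mat n n"
  by (simp add: info_mat_def)

lemma transpose_info_mat: "transpose_mat (info_mat n s N x p) = info_mat n s N x p"
  by (rule eq_matI)
    (auto simp: info_mat_def point_info_def mult.commute split: option.split intro!: sum.cong)

lemma index_congruence_mat:
  fixes R M :: "'a :: comm_semiring_0 mat"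
  assumes "R \<in> carrier_mat n n" "M \<in> carrier_mat n n" "i < n" "j < n"
  shows "(R * (M * transpose_mat R)) $$ (i, j) = (\<Sum>s<n. \<Sum>t<n. R $$ (i, s) * R $$ (j, t) * M $$ (s, t))"
  using assms
  by (simp add: scalar_prod_def atLeast0LessThan sum_distrib_left ac_simps)

text \<open>The law for a single point is linear with constants independent of the point, so
  weighted sums inherit it.\<close>

lemma info_mat_mobius:
  fixes n :: nat
  assumes det: "a * d - b * c \<noteq> 0" and det0: "a0 * d0 - b0 * c0 \<noteq> 0"
    and det': "a' * d' - b' * c' \<noteq> 0"
    and rel: "a' * a + b' * c = k * a0" "a' * b + b' * d = k * b0"
      "c' * a + d' * c = k * c0" "c' * b + d' * d = k * d0"
    and y: "\<And>i. i \<in> {1..N} \<Longrightarrow> y i = mobius a b c d (x i)"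
  defines "R \<equiv> subst_mat n a b c d"
  shows "info_mat n (variance_P n a' b' c' d') N y p
       = inverse (k\<^sup>2 ^ (n - 1)) \<cdot>\<^sub>m (R * (info_mat n (variance_P n a0 b0 c0 d0) N x p * transpose_mat R))"
    (is "?M' = ?\<kappa> \<cdot>\<^sub>m (R * (?M * transpose_mat R))")
proof (rule eq_matI)
  have R: "R \<in> carrier_mat n n" by (simp add: R_def)
  fix i j
  assume "i < dim_row (?\<kappa> \<cdot>\<^sub>m (R * (?M * transpose_mat R)))" "j < dim_col (?\<kappa> \<cdot>\<^sub>m (R * (?M * transpose_mat R)))"
  then have ij: "i < n" "j < n" using R by auto
  let ?P = "\<lambda>l. point_info n (variance_P n a0 b0 c0 d0) (x l)"
  have "?M' $$ (i, j) = (\<Sum>l = 1..N. p l * (?\<kappa> * (\<Sum>s<n. \<Sum>t<n. R $$ (i, s) * R $$ (j, t) * ?P l $$ (s, t))))"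
    using ij y point_info_mobius[OF det det0 det' rel ij]
    by (simp add: info_mat_def R_def)
  also have "\<dots> = (\<Sum>l = 1..N. \<Sum>s<n. \<Sum>t<n. ?\<kappa> * (R $$ (i, s) * R $$ (j, t) * (p l * ?P l $$ (s, t))))"
    by (simp add: sum_distrib_left ac_simps)
  also have "\<dots> = (\<Sum>s<n. \<Sum>t<n. \<Sum>l = 1..N. ?\<kappa> * (R $$ (i, s) * R $$ (j, t) * (p l * ?P l $$ (s, t))))"
    by (subst sum.swap) (rule sum.cong[OF refl sum.swap])
  also have "\<dots> = ?\<kappa> * (\<Sum>s<n. \<Sum>t<n. R $$ (i, s) * R $$ (j, t) * ?M $$ (s, t))"
    by (simp add: info_mat_def sum_distrib_left)
  also have "\<dots> = (?\<kappa> \<cdot>\<^sub>m (R * (?M * transpose_mat R))) $$ (i, j)"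
    using index_congruence_mat[OF R info_mat_carrier ij] ij R by simp
  finally show "?M' $$ (i, j) = (?\<kappa> \<cdot>\<^sub>m (R * (?M * transpose_mat R))) $$ (i, j)" .
qed (simp_all add: info_mat_def R_def subst_mat_def)

section \<open>Inverse matrices\<close>

text \<open>Over a field a right inverse of a square matrix is two-sided. Hence
  \<open>mat_inverse\<close> succeeds, and uniqueness of inverses identifies its result.\<close>

lemma the_mat_inverse_eq:
  fixes A :: "'a :: field mat"
  assumes A: "A \<in> carrier_mat n n" and B: "B \<in> carrier_mat n n"
    and AB: "A * B = 1\<^sub>m n"
  shows "the (mat_inverse A) = B"
proof -
  have BA: "B * A = 1\<^sub>m n" by (rule mat_mult_left_right_inverse[OF A B AB])
  have "A \<in> Units (ring_mat TYPE('a) n undefined)"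
    using A B AB BA by (auto simp: Units_def ring_mat_simps)
  then obtain C where C: "mat_inverse A = Some C"
    using mat_inverse(1)[OF A, of undefined] by (cases "mat_inverse A") auto
  from mat_inverse(2)[OF A C] have CA: "C * A = 1\<^sub>m n" and Cc: "C \<in> carrier_mat n n" by auto
  have "C = C * (A * B)" using AB Cc by simp
  also have "\<dots> = C * A * B" using A B Cc by (simp add: assoc_mult_mat)
  finally show ?thesis using C CA B by simp
qed

text \<open>Transposing \<open>S * M = 1\<^sub>m n\<close> exhibits the transpose of
  \<open>S\<close> as another right inverse of \<open>M\<close>.\<close>

lemma transpose_inverse_eq:
  fixes M :: "'a :: field mat"
  assumes M: "M \<in> carrier_mat n n" and S: "S \<in> carrier_mat n n"
    and MS: "M * S = 1\<^sub>m n" and sym: "transpose_mat M = M"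
  shows "transpose_mat S = S"
proof -
  have SM: "S * M = 1\<^sub>m n" by (rule mat_mult_left_right_inverse[OF M S MS])
  have "M * transpose_mat S = 1\<^sub>m n"
    using transpose_mult[OF S M] SM sym by simp
  then show ?thesis
    using the_mat_inverse_eq[OF M S MS] the_mat_inverse_eq[OF M, of "transpose_mat S"] S by simp
qed

lemma congruence_mat_inverse:
  fixes M R S T :: "'a :: field mat"
  assumes c: "M \<in> carrier_mat n n" "S \<in> carrier_mat n n" "R \<in> carrier_mat n n" "T \<in> carrier_mat n n"
    and MS: "M * S = 1\<^sub>m n" and TR: "T * R = 1\<^sub>m n" and k: "k \<noteq> 0"
  shows "(inverse k \<cdot>\<^sub>m (R * (M * transpose_mat R))) * (k \<cdot>\<^sub>m (transpose_mat T * (S * T))) = 1\<^sub>m n"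
proof -
  have RT: "R * T = 1\<^sub>m n" by (rule mat_mult_left_right_inverse[OF c(4,3) TR])
  have tr: "transpose_mat R * transpose_mat T = 1\<^sub>m n"
    using transpose_mult[OF c(4,3)] TR by simp
  have "(R * (M * transpose_mat R)) * (transpose_mat T * (S * T))
      = R * (M * (transpose_mat R * (transpose_mat T * (S * T))))"
    using c by (simp add: assoc_mult_mat[of _ n n _ n _ n])
  also have "transpose_mat R * (transpose_mat T * (S * T)) = S * T"
    using c tr assoc_mult_mat[of "transpose_mat R" n n "transpose_mat T" n "S * T" n] by simp
  also have "M * (S * T) = T"
    using c MS assoc_mult_mat[of M n n S n T n] by simp
  finally have "(R * (M * transpose_mat R)) * (transpose_mat T * (S * T)) = 1\<^sub>m n"
    using RT by simp
  moreover have "(inverse k \<cdot>\<^sub>m A) * (k \<cdot>\<^sub>m B) = A * B"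
    if "A \<in> carrier_mat n n" "B \<in> carrier_mat n n" for A B :: "'a mat"
    using that k by (intro eq_matI) auto
  ultimately show ?thesis using c by simp
qed

text \<open>The left factor \<open>T\<close> is moved across the scalar product by transposition;
  then \<open>T\<close> cancels \<open>R\<close> on both sides.\<close>

lemma congruence_scalar_prod:
  fixes R S T :: "'a :: field mat"
  assumes c: "S \<in> carrier_mat n n" "R \<in> carrier_mat n n" "T \<in> carrier_mat n n"
    and TR: "T * R = 1\<^sub>m n" and uv: "u \<in> carrier_vec n" "v \<in> carrier_vec n"
  shows "(R *\<^sub>v u) \<bullet> ((k \<cdot>\<^sub>m (transpose_mat T * (S * T))) *\<^sub>v (R *\<^sub>v v)) = k * (u \<bullet> (S *\<^sub>v v))"
proof -
  have TRw: "T *\<^sub>v (R *\<^sub>v w) = w" if "w \<in> carrier_vec n" for w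
    using that c TR by (simp flip: assoc_mult_mat_vec[of _ n n _ n])
  have "(k \<cdot>\<^sub>m (transpose_mat T * (S * T))) *\<^sub>v (R *\<^sub>v v)
      = k \<cdot>\<^sub>v ((transpose_mat T * (S * T)) *\<^sub>v (R *\<^sub>v v))"
    using c uv by (intro smult_mat_mult_vec[of _ n n]) auto
  also have "(transpose_mat T * (S * T)) *\<^sub>v (R *\<^sub>v v) = transpose_mat T *\<^sub>v (S *\<^sub>v v)"
    using c uv TRw by (simp add: assoc_mult_mat_vec[of _ n n _ n])
  finally have "(R *\<^sub>v u) \<bullet> ((k \<cdot>\<^sub>m (transpose_mat T * (S * T))) *\<^sub>v (R *\<^sub>v v))
      = k * ((R *\<^sub>v u) \<bullet> (transpose_mat T *\<^sub>v (S *\<^sub>v v)))"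
    using c uv by simp
  also have "(R *\<^sub>v u) \<bullet> (transpose_mat T *\<^sub>v (S *\<^sub>v v)) = (transpose_mat T *\<^sub>v (S *\<^sub>v v)) \<bullet> (R *\<^sub>v u)"
    using c uv by (intro comm_scalar_prod[of _ n]) auto
  also have "\<dots> = (S *\<^sub>v v) \<bullet> (T *\<^sub>v (R *\<^sub>v u))"
    using c uv by (intro transpose_vec_mult_scalar) auto
  also have "\<dots> = u \<bullet> (S *\<^sub>v v)"
    using c uv TRw by (simp add: comm_scalar_prod[of _ n])
  finally show ?thesis .
qed

section \<open>Transformation of the integrand\<close>

text \<open>For positive definite \<open>S\<close> this is the speed of the normalized curve
  \<open>f / |f|\<close> in the norm defined by \<open>S\<close>.\<close>

definition gram_integrand :: "nat \<Rightarrow> real mat \<Rightarrow> real \<Rightarrow> real" where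
  "gram_integrand n S x =
     sqrt ((f_P n x \<bullet> (S *\<^sub>v f_P n x)) * (g_P n x \<bullet> (S *\<^sub>v g_P n x))
           - (f_P n x \<bullet> (S *\<^sub>v g_P n x))\<^sup>2)
     / (f_P n x \<bullet> (S *\<^sub>v f_P n x))"

lemma Vol1_eq_gram_integrand: "Vol1 n S = 2 * integral\<^sup>L lborel (gram_integrand n S)"
  by (simp add: Vol1_def gram_integrand_def[abs_def])

lemma
  assumes i: "i < n"
  shows f_P_has_derivative: "((\<lambda>t. f_P n t $ i) has_field_derivative g_P n x $ i) (at x)"
    and g_P_nth: "g_P n x $ i = real i * x ^ (i - 1)"
proof -
  have "(\<lambda>t. f_P n t $ i) = (\<lambda>t. t ^ i)" using i by (simp add: f_P_def)
  moreover have "((\<lambda>t. t ^ i) has_field_derivative real i * x ^ (i - 1)) (at x)"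
    by (auto intro!: derivative_eq_intros)
  ultimately have D: "((\<lambda>t. f_P n t $ i) has_field_derivative real i * x ^ (i - 1)) (at x)"
    by (simp only:)
  from DERIV_imp_deriv[OF D] show g: "g_P n x $ i = real i * x ^ (i - 1)"
    using i by (simp add: g_P_def)
  from D show "((\<lambda>t. f_P n t $ i) has_field_derivative g_P n x $ i) (at x)"
    by (simp only: g)
qed


lemma gram_integrand_measurable:
  assumes "S \<in> carrier_mat n n"
  shows "gram_integrand n S \<in> borel_measurable borel"
proof -
  have bil: "v \<bullet> (S *\<^sub>v w) = (\<Sum>i<n. v $ i * (\<Sum>j<n. S $$ (i, j) * w $ j))"
    if "w \<in> carrier_vec n" for v w
    using assms that by (simp add: scalar_prod_def atLeast0LessThan)
  show ?thesis
    unfolding gram_integrand_def[abs_def] bil[OF f_P_carrier] bil[OF g_P_carrier]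
    by (simp add: f_P_def g_P_nth)
qed

lemma mobius_has_derivative:
  fixes a b c d x :: real
  assumes "c * x + d \<noteq> 0"
  shows "((\<lambda>t. (a * t + b) / (c * t + d)) has_field_derivative (a * d - b * c) / (c * x + d)\<^sup>2) (at x)"
  using assms by (auto intro!: derivative_eq_intros simp: power2_eq_square algebra_simps)

text \<open>Differentiating \<open>R f = (c x + d)\<^sup>n\<^sup>-\<^sup>1 f(\<phi>(x))\<close> shows that \<open>(R f, R g)\<close> is a triangular
  combination of \<open>f\<close> and \<open>g\<close> at \<open>\<phi>(x)\<close>.\<close>

lemma subst_mat_f_P_g_P:
  fixes n :: nat and a b c d x :: real
  assumes nz: "c * x + d \<noteq> 0"
  defines "R \<equiv> subst_mat n a b c d" and "\<phi> \<equiv> \<lambda>t. (a * t + b) / (c * t + d)"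
    and "h \<equiv> (c * x + d) ^ (n - 1)"
  obtains h' where "R *\<^sub>v f_P n x = h \<cdot>\<^sub>v f_P n (\<phi> x)"
    "R *\<^sub>v g_P n x = h' \<cdot>\<^sub>v f_P n (\<phi> x) + (h * ((a * d - b * c) / (c * x + d)\<^sup>2)) \<cdot>\<^sub>v g_P n (\<phi> x)"
proof
  \<comment> \<open>The derivative of \<open>(c * t + d) ^ (n - 1)\<close> at \<open>x\<close>; the
    factor \<open>real (n - 1)\<close> vanishes when the exponent \<open>n - 1 - 1\<close> is
    truncated.\<close>
  define h' where "h' = real (n - 1) * (c * x + d) ^ (n - 1 - 1) * c"
  let ?D = "(a * d - b * c) / (c * x + d)\<^sup>2"
  have f: "R *\<^sub>v f_P n t = (c * t + d) ^ (n - 1) \<cdot>\<^sub>v f_P n (\<phi> t)" if "c * t + d \<noteq> 0" for t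
  proof -
    have "R *\<^sub>v f_P n t = moment_vec n ((c * t + d) * \<phi> t) ((c * t + d) * 1)"
      using that by (simp add: R_def f_P_eq_moment_vec subst_mat_moment_vec \<phi>_def)
    then show ?thesis unfolding moment_vec_scale by (simp add: f_P_eq_moment_vec)
  qed
  then show "R *\<^sub>v f_P n x = h \<cdot>\<^sub>v f_P n (\<phi> x)" using nz by (simp add: h_def)
  have Rc: "R \<in> carrier_mat n n" by (simp add: R_def)
  show "R *\<^sub>v g_P n x = h' \<cdot>\<^sub>v f_P n (\<phi> x) + (h * ?D) \<cdot>\<^sub>v g_P n (\<phi> x)"
  proof (rule eq_vecI)
    fix i assume "i < dim_vec (h' \<cdot>\<^sub>v f_P n (\<phi> x) + (h * ?D) \<cdot>\<^sub>v g_P n (\<phi> x))"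
    then have i: "i < n" by (simp add: g_P_def)
    have row: "(R *\<^sub>v v) $ i = (\<Sum>j<n. R $$ (i, j) * v $ j)" if "v \<in> carrier_vec n" for v
      using that Rc i by (simp add: scalar_prod_def atLeast0LessThan)
    have L: "((\<lambda>t. (R *\<^sub>v f_P n t) $ i) has_field_derivative (R *\<^sub>v g_P n x) $ i) (at x)"
      unfolding row[OF f_P_carrier] row[OF g_P_carrier]
      by (intro DERIV_sum DERIV_cmult f_P_has_derivative) simp
    have h: "((\<lambda>t. (c * t + d) ^ (n - 1)) has_field_derivative h') (at x)"
      unfolding h'_def by (auto intro!: derivative_eq_intros)
    have "((\<lambda>t. f_P n (\<phi> t) $ i) has_field_derivative g_P n (\<phi> x) $ i * ?D) (at x)"
      using DERIV_chain2[OF f_P_has_derivative[OF i] mobius_has_derivative[OF nz]]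
      by (simp add: \<phi>_def)
    from DERIV_mult[OF h this]
    have "((\<lambda>t. (c * t + d) ^ (n - 1) * f_P n (\<phi> t) $ i) has_field_derivative
        h' * f_P n (\<phi> x) $ i + g_P n (\<phi> x) $ i * ?D * h) (at x)"
      by (simp add: h_def)
    \<comment> \<open>The identity \<open>f\<close> is available only off the pole, an open set
      containing \<open>x\<close>, which suffices to compare derivatives.\<close>
    moreover have "\<forall>\<^sub>F t in nhds x. (c * t + d) ^ (n - 1) * f_P n (\<phi> t) $ i = (R *\<^sub>v f_P n t) $ i"
    proof -
      have "open {t. c * t + d \<noteq> 0}" by (intro open_Collect_neq continuous_intros)
      then have "\<forall>\<^sub>F t in nhds x. t \<in> {t. c * t + d \<noteq> 0}"
        using nz by (intro eventually_nhds_in_open) auto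
      then show ?thesis
        by (rule eventually_mono) (use i f in \<open>auto simp: f_P_def\<close>)
    qed
    ultimately have "((\<lambda>t. (R *\<^sub>v f_P n t) $ i) has_field_derivative
        h' * f_P n (\<phi> x) $ i + g_P n (\<phi> x) $ i * ?D * h) (at x)"
      using DERIV_cong_ev by fastforce
    from DERIV_unique[OF L this]
    show "(R *\<^sub>v g_P n x) $ i = (h' \<cdot>\<^sub>v f_P n (\<phi> x) + (h * ?D) \<cdot>\<^sub>v g_P n (\<phi> x)) $ i"
      using i by (simp add: mult.commute)
  qed (use Rc in simp)
qed

text \<open>A triangular change of basis with diagonal \<open>h\<close>, \<open>h * D\<close>
  multiplies the Gram determinant by \<open>(h ^ 2 * D) ^ 2\<close> and the squared norm of
  \<open>f\<close> by \<open>h ^ 2\<close>. The off-diagonal \<open>h'\<close> drops out,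
  \<open>k\<close> cancels, and the factor \<open>\<bar>D\<bar>\<close> remains.\<close>

lemma gram_integrand_mobius:
  fixes a b c d x :: real
  assumes nz: "c * x + d \<noteq> 0" and k: "k > 0"
    and S: "S \<in> carrier_mat n n" and S': "S' \<in> carrier_mat n n" and sym: "transpose_mat S' = S'"
    and cong: "\<And>u v. u \<in> carrier_vec n \<Longrightarrow> v \<in> carrier_vec n \<Longrightarrow>
      (subst_mat n a b c d *\<^sub>v u) \<bullet> (S' *\<^sub>v (subst_mat n a b c d *\<^sub>v v)) = k * (u \<bullet> (S *\<^sub>v v))"
  shows "\<bar>(a * d - b * c) / (c * x + d)\<^sup>2\<bar> * gram_integrand n S' ((a * x + b) / (c * x + d))
       = gram_integrand n S x"
proof -
  define R where "R = subst_mat n a b c d"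
  define y where "y = (a * x + b) / (c * x + d)"
  define D where "D = (a * d - b * c) / (c * x + d)\<^sup>2"
  define h where "h = (c * x + d) ^ (n - 1)"
  have h0: "h \<noteq> 0" using nz by (simp add: h_def)
  obtain h' where Rf: "R *\<^sub>v f_P n x = h \<cdot>\<^sub>v f_P n y"
    and Rg: "R *\<^sub>v g_P n x = h' \<cdot>\<^sub>v f_P n y + (h * D) \<cdot>\<^sub>v g_P n y"
    unfolding R_def y_def D_def h_def using subst_mat_f_P_g_P[OF nz] by metis
  define B where "B = (\<lambda>v w. v \<bullet> (S' *\<^sub>v w))"
  have comm: "B (g_P n y) (f_P n y) = B (f_P n y) (g_P n y)"
    unfolding B_def using transpose_vec_mult_scalar[OF S' f_P_carrier g_P_carrier, of y y] sym S'
    by (simp add: comm_scalar_prod[of _ n])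
  have B_add: "B (s \<cdot>\<^sub>v v + t \<cdot>\<^sub>v w) z = s * B v z + t * B w z"
    "B z (s \<cdot>\<^sub>v v + t \<cdot>\<^sub>v w) = s * B z v + t * B z w"
    if "v \<in> carrier_vec n" "w \<in> carrier_vec n" "z \<in> carrier_vec n" for s t v w z
    using that S' unfolding B_def
    by (simp_all add: mult_add_distrib_mat_vec[of _ n n] mult_mat_vec[of _ n n]
        add_scalar_prod_distrib[of _ n] scalar_prod_add_distrib[of _ n])
  have B_smult: "B (s \<cdot>\<^sub>v v) w = s * B v w" "B v (s \<cdot>\<^sub>v w) = s * B v w"
    if "v \<in> carrier_vec n" "w \<in> carrier_vec n" for s v w
    using that S' unfolding B_def by (simp_all add: mult_mat_vec[of _ n n])
  have kB: "B (R *\<^sub>v v) (R *\<^sub>v w) = k * (v \<bullet> (S *\<^sub>v w))"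
    if "v \<in> carrier_vec n" "w \<in> carrier_vec n" for v w
    unfolding B_def R_def using cong that .
  define ff fg gg where "ff = B (f_P n y) (f_P n y)" and "fg = B (f_P n y) (g_P n y)"
    and "gg = B (g_P n y) (g_P n y)"
  define F G H where "F = f_P n x \<bullet> (S *\<^sub>v f_P n x)" and "G = f_P n x \<bullet> (S *\<^sub>v g_P n x)"
    and "H = g_P n x \<bullet> (S *\<^sub>v g_P n x)"
  have kF: "k * F = h\<^sup>2 * ff"
    using kB[OF f_P_carrier f_P_carrier, of x x]
    by (simp add: Rf B_smult F_def ff_def power2_eq_square)
  have kG: "k * G = h * h' * ff + h\<^sup>2 * D * fg"
    using kB[OF f_P_carrier g_P_carrier, of x x]
    by (simp add: Rf Rg B_add B_smult G_def ff_def fg_def power2_eq_square algebra_simps)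
  have kH: "k * H = h'\<^sup>2 * ff + 2 * h * h' * D * fg + h\<^sup>2 * D\<^sup>2 * gg"
    using kB[OF g_P_carrier g_P_carrier, of x x]
    by (simp add: Rg B_add comm H_def ff_def fg_def gg_def power2_eq_square algebra_simps)
  have "k\<^sup>2 * (F * H - G\<^sup>2) = (k * F) * (k * H) - (k * G)\<^sup>2"
    by (simp add: power2_eq_square algebra_simps)
  also have "\<dots> = (h\<^sup>2 * D)\<^sup>2 * (ff * gg - fg\<^sup>2)"
    unfolding kF kG kH by (simp add: power2_eq_square algebra_simps)
  finally have "sqrt (k\<^sup>2 * (F * H - G\<^sup>2)) = sqrt ((h\<^sup>2 * D)\<^sup>2 * (ff * gg - fg\<^sup>2))" by simp
  \<comment> \<open>\<open>sqrt\<close> is multiplicative on all reals, so the sign of the Gram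
    determinants does not matter.\<close>
  then have "k * sqrt (F * H - G\<^sup>2) = h\<^sup>2 * \<bar>D\<bar> * sqrt (ff * gg - fg\<^sup>2)"
    using k by (simp add: real_sqrt_mult abs_mult)
  then have "(k * sqrt (F * H - G\<^sup>2)) / (k * F) = (h\<^sup>2 * \<bar>D\<bar> * sqrt (ff * gg - fg\<^sup>2)) / (h\<^sup>2 * ff)"
    unfolding kF by simp
  \<comment> \<open>Only \<open>k\<close> and \<open>h ^ 2\<close> are cancelled. If
    \<open>F\<close> vanishes, so does \<open>ff\<close> by \<open>kF\<close>, and both quotients
    are 0 by convention.\<close>
  then have "sqrt (F * H - G\<^sup>2) / F = \<bar>D\<bar> * (sqrt (ff * gg - fg\<^sup>2) / ff)"
    using k h0 by simp
  then show ?thesis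
    by (simp add: gram_integrand_def F_def G_def H_def ff_def fg_def gg_def B_def D_def y_def)
qed

section \<open>Change of variables\<close>

text \<open>Absolute integrability transfers in both directions, so the integrals also agree when
  neither function is integrable: both are then 0 by convention.\<close>

lemma lborel_integral_change_of_variables:
  fixes u v \<phi> \<phi>' :: "real \<Rightarrow> real"
  assumes u: "u \<in> borel_measurable borel" and v: "v \<in> borel_measurable borel"
    and P: "negligible (- P)" and Q: "negligible (- (\<phi> ` P))"
    and inj: "inj_on \<phi> P"
    and der: "\<And>x. x \<in> P \<Longrightarrow> (\<phi> has_field_derivative \<phi>' x) (at x)"
    and eq: "\<And>x. x \<in> P \<Longrightarrow> \<bar>\<phi>' x\<bar> * u (\<phi> x) = v x"
  shows "integral\<^sup>L lborel u = integral\<^sup>L lborel v"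
proof -
  \<comment> \<open>Bridge from integrals over sets to \<open>lborel\<close>: a negligible set
    changes neither integrability nor value, and for Borel functions completing the measure has no
    effect.\<close>
  have abs_iff: "w absolutely_integrable_on A \<longleftrightarrow> integrable lborel w"
    and int_eq: "integrable lborel w \<Longrightarrow> integral A w = integral\<^sup>L lborel w"
    if w: "w \<in> borel_measurable borel" and A: "negligible (- A)" for w :: "real \<Rightarrow> real" and A
  proof -
    have "w absolutely_integrable_on A \<longleftrightarrow> w absolutely_integrable_on UNIV"
      by (rule absolutely_integrable_spike_set_eq) (auto intro: negligible_subset[OF A])
    also have "\<dots> \<longleftrightarrow> integrable lborel w"
      using w by (simp add: set_integrable_def integrable_completion)
    finally show "w absolutely_integrable_on A \<longleftrightarrow> integrable lborel w" .
    show "integral A w = integral\<^sup>L lborel w" if "integrable lborel w"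
    proof -
      have "integral A w = integral UNIV w"
        by (rule integral_spike_set) (auto intro: negligible_subset[OF A])
      also have "\<dots> = integral\<^sup>L lborel w"
        using integral_lborel[OF that] by simp
      finally show ?thesis .
    qed
  qed
  have P_meas: "P \<in> sets lebesgue"
    using negligible_imp_sets[OF P] by (metis Compl_in_sets_lebesgue)
  have "(\<lambda>x. \<bar>\<phi>' x\<bar> * u (\<phi> x)) absolutely_integrable_on P \<longleftrightarrow> v absolutely_integrable_on P"
    using eq by (intro set_integrable_cong) auto
  moreover have "integral P (\<lambda>x. \<bar>\<phi>' x\<bar> * u (\<phi> x)) = integral P v"
    using eq by (intro Henstock_Kurzweil_Integration.integral_cong) auto
  moreover have "(\<lambda>x. \<bar>\<phi>' x\<bar> * u (\<phi> x)) absolutely_integrable_on P \<and>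
      integral P (\<lambda>x. \<bar>\<phi>' x\<bar> * u (\<phi> x)) = r
      \<longleftrightarrow> u absolutely_integrable_on (\<phi> ` P) \<and> integral (\<phi> ` P) u = r" for r
    by (rule has_absolute_integral_change_of_variables_1'[OF P_meas _ inj])
      (rule has_field_derivative_at_within[OF der])
  ultimately have *: "v absolutely_integrable_on P \<and> integral P v = r
      \<longleftrightarrow> u absolutely_integrable_on (\<phi> ` P) \<and> integral (\<phi> ` P) u = r" for r
    by simp
  show ?thesis
  proof (rule integral_eq_cases)
    show iff: "integrable lborel u \<longleftrightarrow> integrable lborel v"
      using * abs_iff[OF u Q] abs_iff[OF v P] by blast
    show "integral\<^sup>L lborel u = integral\<^sup>L lborel v" if "integrable lborel u" "integrable lborel v"
      using * that abs_iff[OF u Q] abs_iff[OF v P] int_eq[OF u Q] int_eq[OF v P] by metis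
  qed
qed

text \<open>Off its pole \<phi> is injective and misses at most the point \<open>a / c\<close>, so
  domain and image have finite complements and the pointwise law for the integrand can be
  integrated.\<close>

lemma Vol1_congruence:
  fixes a b c d :: real
  assumes det: "a * d - b * c \<noteq> 0" and k: "k > 0"
    and S: "S \<in> carrier_mat n n" and S': "S' \<in> carrier_mat n n" and sym: "transpose_mat S' = S'"
    and cong: "\<And>u v. u \<in> carrier_vec n \<Longrightarrow> v \<in> carrier_vec n \<Longrightarrow>
      (subst_mat n a b c d *\<^sub>v u) \<bullet> (S' *\<^sub>v (subst_mat n a b c d *\<^sub>v v)) = k * (u \<bullet> (S *\<^sub>v v))"
  shows "Vol1 n S' = Vol1 n S"
proof -
  define \<phi> where "\<phi> = (\<lambda>t. (a * t + b) / (c * t + d))"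
  define P where "P = {t. c * t + d \<noteq> 0}"
  have finite_zeros: "finite {t. r * t + s = 0}" if "r \<noteq> 0 \<or> s \<noteq> 0" for r s :: real
  proof (cases "r = 0")
    case False
    then have "{t. r * t + s = 0} \<subseteq> {- s / r}" by (auto simp: field_simps)
    then show ?thesis by (rule finite_subset) simp
  qed (use that in simp)
  \<comment> \<open>Denominator and numerator of the inverse Moebius map at \<open>\<phi> t\<close>;
    equality of the former, then of the latter, yields injectivity.\<close>
  have inv: "- c * \<phi> t + a = (a * d - b * c) / (c * t + d)"
    "d * \<phi> t - b = (a * d - b * c) * t / (c * t + d)" if "t \<in> P" for t
    using that by (simp_all add: \<phi>_def P_def divide_simps) (simp_all add: algebra_simps)
  have "integral\<^sup>L lborel (gram_integrand n S') = integral\<^sup>L lborel (gram_integrand n S)"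
  proof (rule lborel_integral_change_of_variables)
    show "negligible (- P)"
    proof (rule negligible_finite)
      have "- P = {t. c * t + d = 0}" by (auto simp: P_def)
      then show "finite (- P)" using finite_zeros[of c d] det by (cases "c = 0") auto
    qed
    show "negligible (- (\<phi> ` P))"
    proof (rule negligible_subset[OF negligible_finite])
      show "finite {t. - c * t + a = 0}" using finite_zeros[of "- c" a] det by (cases "c = 0") auto
      show "- (\<phi> ` P) \<subseteq> {t. - c * t + a = 0}"
      proof (rule subsetI, rule ccontr)
        fix t assume t: "t \<in> - (\<phi> ` P)" "t \<notin> {t. - c * t + a = 0}"
        \<comment> \<open>The preimage of \<open>t\<close> given by the inverse Moebius map.\<close>
        define s where "s = (d * t - b) / (- c * t + a)"
        have nz: "- c * t + a \<noteq> 0" using t by simp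
        have "c * s + d = (a * d - b * c) / (- c * t + a)"
          "a * s + b = (a * d - b * c) * t / (- c * t + a)"
          using nz by (simp_all add: s_def divide_simps) (simp_all add: algebra_simps)
        then have "s \<in> P" "\<phi> s = t" using det nz by (simp_all add: P_def \<phi>_def)
        then show False using t by auto
      qed
    qed
    show "inj_on \<phi> P"
    proof (rule inj_onI)
      fix s t assume st: "s \<in> P" "t \<in> P" "\<phi> s = \<phi> t"
      have q: "(a * d - b * c) / (c * s + d) = (a * d - b * c) / (c * t + d)"
        and m: "(a * d - b * c) * s / (c * s + d) = (a * d - b * c) * t / (c * t + d)"
        using inv[OF st(1)] inv[OF st(2)] st(3) by metis+
      from q have "c * s + d = c * t + d" using st det by (auto simp: P_def frac_eq_eq)
      with m show "s = t" using st det by (simp add: P_def)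
    qed
    show "(\<phi> has_field_derivative (a * d - b * c) / (c * t + d)\<^sup>2) (at t)" if "t \<in> P" for t
      using that unfolding \<phi>_def P_def by (intro mobius_has_derivative) simp
    show "\<bar>(a * d - b * c) / (c * t + d)\<^sup>2\<bar> * gram_integrand n S' (\<phi> t) = gram_integrand n S t"
      if "t \<in> P" for t
      unfolding \<phi>_def by (rule gram_integrand_mobius[OF _ k S S' sym cong]) (use that in \<open>auto simp: P_def\<close>)
  qed (use S S' gram_integrand_measurable in auto)
  then show ?thesis by (simp add: Vol1_eq_gram_integrand)
qed

theorem theorem3p17:
  fixes n N :: nat
    and a0 b0 c0 d0 a b c d a' b' c' d' :: real
    and x y :: "nat \<Rightarrow> real option" and p :: "nat \<Rightarrow> real"
  assumes "n \<ge> 2"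
    and "a0 * d0 - b0 * c0 \<noteq> 0"
    and "a * d - b * c \<noteq> 0"
    and "design_weights N p"
    and "invertible_mat (info_mat n (variance_P n a0 b0 c0 d0) N x p)"
    and "\<And>i. i \<in> {1..N} \<Longrightarrow> y i = mobius a b c d (x i)"
    and "a' * d' - b' * c' \<noteq> 0"
    and "mobius a' b' c' d' = mobius a0 b0 c0 d0 \<circ> inv_into UNIV (mobius a b c d)"
  shows "design_volume n (variance_P n a' b' c' d') N y p
       = design_volume n (variance_P n a0 b0 c0 d0) N x p"
proof -
  note det0 = assms(2) and det = assms(3) and y = assms(6) and det' = assms(7)
  \<comment> \<open>The four entries form the product of the matrices of the primed map and of
    \<phi>, so the determinant is multiplicative.\<close>
  have detE: "(a' * a + b' * c) * (c' * b + d' * d) - (a' * b + b' * d) * (c' * a + d' * c) \<noteq> 0"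
  proof -
    have "(a' * a + b' * c) * (c' * b + d' * d) - (a' * b + b' * d) * (c' * a + d' * c)
        = (a' * d' - b' * c') * (a * d - b * c)"
      by (simp add: algebra_simps)
    then show ?thesis using det det' by simp
  qed
  \<comment> \<open>Composing the hypothesis with \<open>mobius a b c d\<close> removes the inverse:
    the product matrix and the original parameters define the same map.\<close>
  have "mobius (a' * a + b' * c) (a' * b + b' * d) (c' * a + d' * c) (c' * b + d' * d) z
      = mobius a0 b0 c0 d0 z" for z
  proof -
    obtain u v where z: "z = proj_pt u v" and uv: "u \<noteq> 0 \<or> v \<noteq> 0" by (rule proj_pt_exhaust)
    have "mobius a' b' c' d' (mobius a b c d z) = mobius a0 b0 c0 d0 z"
      unfolding assms(8) inv_mobius[OF det] by (simp add: mobius_cancel[OF det])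
    then show ?thesis
      unfolding z mobius_proj_pt[OF det uv] mobius_proj_pt[OF det' linear_map_nonzero[OF det uv]]
        mobius_proj_pt[OF detE uv]
      by (simp add: algebra_simps)
  qed
  then obtain l where l: "l \<noteq> 0" and rel: "a' * a + b' * c = l * a0" "a' * b + b' * d = l * b0"
      "c' * a + d' * c = l * c0" "c' * b + d' * d = l * d0"
    using mobius_eq_imp_proportional[OF det0 detE] by blast
  \<comment> \<open>The scalar enters squared, so \<open>k\<close> is positive whatever the sign of
    \<open>l\<close>.\<close>
  define k where "k = l\<^sup>2 ^ (n - 1)"
  have k: "k > 0" using l by (simp add: k_def)
  define R where "R = subst_mat n a b c d"
  have R: "R \<in> carrier_mat n n" by (simp add: R_def)
  obtain T where T: "T \<in> carrier_mat n n" and TR: "T * R = 1\<^sub>m n"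
    unfolding R_def using subst_mat_left_inverse[OF det] .
  define M where "M = info_mat n (variance_P n a0 b0 c0 d0) N x p"
  have M: "M \<in> carrier_mat n n" by (simp add: M_def)
  obtain S where MS: "M * S = 1\<^sub>m n" and S: "S \<in> carrier_mat n n"
  proof -
    from assms(5) obtain S where "M * S = 1\<^sub>m n" "S * M = 1\<^sub>m (dim_row S)"
      unfolding invertible_mat_def inverts_mat_def M_def[symmetric] using M by auto
    moreover from this have "S \<in> carrier_mat n n"
      using M by (metis carrier_matD carrier_matI index_mult_mat(2,3) index_one_mat(2,3))
    ultimately show thesis using that by blast
  qed
  \<comment> \<open>The inverse of \<open>R * (M * transpose_mat R)\<close> divided by
    \<open>k\<close>, written with \<open>T\<close> as the inverse of \<open>R\<close>.\<close>
  define S' where "S' = k \<cdot>\<^sub>m (transpose_mat T * (S * T))"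
  have S': "S' \<in> carrier_mat n n" using S T by (simp add: S'_def)
  define M' where "M' = info_mat n (variance_P n a' b' c' d') N y p"
  have M': "M' \<in> carrier_mat n n" by (simp add: M'_def)
  have "M' = inverse k \<cdot>\<^sub>m (R * (M * transpose_mat R))"
    unfolding M'_def k_def R_def M_def by (rule info_mat_mobius[OF det det0 det' rel y])
  then have M'S': "M' * S' = 1\<^sub>m n"
    unfolding S'_def using congruence_mat_inverse[OF M S R T MS TR] k by simp
  have "Vol1 n S' = Vol1 n S"
  proof (rule Vol1_congruence[OF det k S S'])
    show "transpose_mat S' = S'"
      using transpose_inverse_eq[OF M' S' M'S'] by (simp add: M'_def transpose_info_mat)
    show "(subst_mat n a b c d *\<^sub>v u) \<bullet> (S' *\<^sub>v (subst_mat n a b c d *\<^sub>v v)) = k * (u \<bullet> (S *\<^sub>v v))"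
      if "u \<in> carrier_vec n" "v \<in> carrier_vec n" for u v
      using congruence_scalar_prod[OF S R T TR that] by (simp add: S'_def R_def)
  qed
  then show ?thesis
    unfolding design_volume_def M_def[symmetric] M'_def[symmetric]
    using the_mat_inverse_eq[OF M S MS] the_mat_inverse_eq[OF M' S' M'S'] by simp
qed

end
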